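(* Suppose $p,q,r$ satisfy $1<q<2<p<\infty$ and $1/r=1/q-1/p$. Let $\alpha,\beta\in(0,1)$ be such that $$\frac12<\frac\beta q<\frac\alpha{p'}<\frac1q<1.$$ Let $U(k)=(|k|+1)^{\beta-1}$ for $k\in\mathbb Z$, and $W(x)=x^{(1-\alpha)(p-1)}$ for $0\le x<1$. Let $u=U^*$ be the rearrangement of $U$ with respect to counting measure on $\mathbb Z$ and define $w$ on $(0,\infty)$ by $1/w=(1/W)^*$, the rearrangement being with respect to Lebesgue measure on $\mathbb T=[0,1]$. Then $$\bigg(\int_0^\infty\bigg(\int_0^x u\bigg)^{r/p}\bigg(\int_0^{1/x}w^{1-p'}\bigg)^{r/p'}u(x)\,dx\bigg)^{1/r}<\infty,$$ but there is no finite constant $C$ such that $$\bigg(\sum_{k\in\mathbb Z}|\hat f(k)|^qU(k)\bigg)^{1/q}\le C\bigg(\int_0^1|f(x)|^pW(x)\,dx\bigg)^{1/p}$$ for all $f\in L^1(\mathbb T)$.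
   Context: For $f\in L^1(\mathbb T)$, with $\mathbb T$ identified with $[0,1]$, the Fourier coefficients are $\hat f(k)=\int_0^1 f(x)e^{-2\pi i kx}\,dx$, $k\in\mathbb Z$. For a $\mu$-measurable function $f$, the non-increasing rearrangement with respect to $\mu$ is $f^*(t)=\inf\{\alpha>0:\mu_f(\alpha)\le t\}$, $t>0$, where $\mu_f(\alpha)=\mu\{x:|f(x)|>\alpha\}$. In particular $(1/W)^*(t)=0$, i.e. $w(t)=\infty$ and $w(t)^{1-p'}=0$, for $t\ge1$. Conjugate indices: $1/p+1/p'=1$. *)

theory Defs
  imports "HOL-Analysis.Analysis"
begin

text \<open>Real powers of extended nonnegative numbers, with the usual conventions
  \<open>\<infinity>\<^sup>a = \<infinity>\<close>, \<open>0\<^sup>a = 0\<close> for \<open>a > 0\<close> and \<open>\<infinity>\<^sup>a = 0\<close>, \<open>0\<^sup>a = \<infinity>\<close> for \<open>a < 0\<close>.\<close>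

definition enn_powr :: "ennreal \<Rightarrow> real \<Rightarrow> ennreal" where
  "enn_powr x a =
     (if a = 0 then 1
      else if x = 0 then (if a > 0 then 0 else \<infinity>)
      else if x = \<infinity> then (if a > 0 then \<infinity> else 0)
      else ennreal (enn2real x powr a))"

definition torus :: "real measure" where
  "torus = lebesgue_on {0..1}"

text \<open>Scalars are \<open>ennreal\<close>-valued so that \<open>1 / W\<close> may be infinite where \<open>W = 0\<close>; for
  a real or complex function \<open>g\<close> these two notions are to be applied to \<open>\<lambda>x. ennreal (norm (g x))\<close>.\<close>

definition distr_fun :: "'a measure \<Rightarrow> ('a \<Rightarrow> ennreal) \<Rightarrow> real \<Rightarrow> ennreal" where
  "distr_fun M f \<alpha> = emeasure M {x \<in> space M. f x > ennreal \<alpha>}"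

definition rearrangement :: "'a measure \<Rightarrow> ('a \<Rightarrow> ennreal) \<Rightarrow> real \<Rightarrow> ennreal" where
  "rearrangement M f t = Inf {ennreal \<alpha> | \<alpha>. \<alpha> > 0 \<and> distr_fun M f \<alpha> \<le> ennreal t}"

definition fourier_coeff :: "(real \<Rightarrow> complex) \<Rightarrow> int \<Rightarrow> complex" where
  "fourier_coeff f k =
     (\<integral>x. f x * exp (- (2 * complex_of_real pi * \<i> * of_int k * complex_of_real x)) \<partial>torus)"

end

(* On the positive side, u and w^(1-p') are dominated by powers t^(beta-1) and t^(alpha-1),
   the latter cut off at t = 1, so the integrand is dominated by a power exceeding -1 near 0
   and by a power below -1 near infinity.  On the negative side, Rudin-Shapiro polynomials
   normalised to |f| <= 1 have 2^n Fourier coefficients of modulus 2^(-(n+1)/2); since W <= 1 and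
   beta/q > 1/2, the left-hand side of the inequality grows like 2^(n(beta/q-1/2)) while the
   integral on the right stays bounded by 1. *)

theory Submission
  imports Defs "HOL-Real_Asymp.Real_Asymp"
begin

section \<open>Extended real powers and integrals of power functions\<close>

lemma enn_powr_ennreal:
  assumes "0 \<le> x" "0 < a"
  shows "enn_powr (ennreal x) a = ennreal (x powr a)"
  using assms by (auto simp: enn_powr_def ennreal_eq_0_iff)

lemma enn_powr_mono:
  assumes "x \<le> y" "0 < a"
  shows "enn_powr x a \<le> enn_powr y a"
proof (cases y)
  case (real b)
  then obtain c where "x = ennreal c" "0 \<le> c" "c \<le> b"
    using assms by (cases x) (auto simp: top_unique)
  then show ?thesis
    using real assms by (simp add: enn_powr_ennreal powr_mono2 ennreal_leI)
next
  case top
  then show ?thesis using assms by (simp add: enn_powr_def)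
qed

text \<open>Since \<open>a > 0\<close>, the majorant is integrable at 0 and has primitive
  \<open>A / a * s powr a\<close>. Only monotonicity of the integral touches \<open>g\<close>, so
  \<open>u\<close> and the power of \<open>w\<close> can be inserted without a measurability
  proof.\<close>

lemma nn_integral_Ioo_powr_le:
  fixes g :: "real \<Rightarrow> ennreal"
  assumes "0 \<le> A" "0 < a" "0 \<le> c"
    and g: "\<And>s. 0 < s \<Longrightarrow> s < c \<Longrightarrow> g s \<le> ennreal (A * s powr (a - 1))"
  shows "(\<integral>\<^sup>+s\<in>{0<..<c}. g s \<partial>lborel) \<le> ennreal (A / a * c powr a)"
proof -
  have "((\<lambda>s. A * s powr (a - 1)) has_integral A * (c powr (a - 1 + 1) / (a - 1 + 1))) {0..c}"
    using assms by (intro has_integral_mult_right has_integral_powr_from_0) auto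
  then have "(\<integral>\<^sup>+s\<in>{0..c}. ennreal (A * s powr (a - 1)) \<partial>lborel) = ennreal (A / a * c powr a)"
    using assms by (subst nn_integral_has_integral_lebesgue') auto
  moreover have "(\<integral>\<^sup>+s\<in>{0<..<c}. g s \<partial>lborel)
      \<le> (\<integral>\<^sup>+s\<in>{0..c}. ennreal (A * s powr (a - 1)) \<partial>lborel)"
    by (intro nn_integral_mono) (auto simp: indicator_def g)
  ultimately show ?thesis by simp
qed

lemma nn_integral_atLeast_powr:
  fixes K e :: real
  assumes "0 \<le> K" "e < 0"
  shows "(\<integral>\<^sup>+s\<in>{1..}. ennreal (K * s powr (e - 1)) \<partial>lborel) < \<infinity>"
proof -
  have "((\<lambda>s. K * s powr (e - 1)) has_integral K * (- (1 powr (e - 1 + 1)) / (e - 1 + 1))) {1..}"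
    using assms by (intro has_integral_mult_right has_integral_powr_to_inf) auto
  then show ?thesis
    using assms by (subst nn_integral_has_integral_lebesgue') auto
qed

lemma one_divide_ennreal: "0 < x \<Longrightarrow> 1 / ennreal x = ennreal (1 / x)"
  using divide_ennreal[of 1 x] by simp

section \<open>Rearrangements of the two weights\<close>

lemma rearrangement_le:
  assumes "0 < \<alpha>" "distr_fun M f \<alpha> \<le> ennreal t"
  shows "rearrangement M f t \<le> ennreal \<alpha>"
  unfolding rearrangement_def using assms by (intro Inf_lower) auto

text \<open>The infimum runs over strictly positive levels, so 0 is approached and not attained;
  hence the epsilon argument.\<close>

lemma rearrangement_eq_0:
  assumes "\<And>\<alpha>. 0 < \<alpha> \<Longrightarrow> distr_fun M f \<alpha> \<le> ennreal t"
  shows "rearrangement M f t = 0"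
proof -
  have "rearrangement M f t \<le> 0"
    by (rule ennreal_le_epsilon) (simp add: rearrangement_le assms)
  then show ?thesis by simp
qed

text \<open>The level \<open>(t / 2) powr b\<close> is tested: as \<open>b < 0\<close>, exceeding it
  means |k| + 1 < t/2. Both signs of k count, which is why t is halved; at most t - 1 integers
  remain once the set is nonempty.\<close>

lemma rearrangement_int_powr_le:
  fixes b t :: real
  assumes b: "b < 0" and t: "0 < t"
  shows "rearrangement (count_space UNIV) (\<lambda>k::int. ennreal ((\<bar>real_of_int k\<bar> + 1) powr b)) t
    \<le> ennreal ((t / 2) powr b)"
proof (rule rearrangement_le)
  show "0 < (t / 2) powr b" using t by simp
  let ?S = "{k::int. ennreal ((\<bar>real_of_int k\<bar> + 1) powr b) > ennreal ((t / 2) powr b)}"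
  have S: "\<bar>real_of_int k\<bar> + 1 < t / 2" if "k \<in> ?S" for k
  proof (rule ccontr)
    assume "\<not> \<bar>real_of_int k\<bar> + 1 < t / 2"
    then have "(\<bar>real_of_int k\<bar> + 1) powr b \<le> (t / 2) powr b"
      using b t by (intro powr_mono2') auto
    then show False using that by (auto simp: ennreal_less_iff)
  qed
  \<comment> \<open>For t < 2 this is negative and \<open>{-m..m}\<close> is empty, while the count
    2m + 1 is meaningful only for m \<ge> 0; hence the case distinction below.\<close>
  define m where "m = \<lfloor>t / 2 - 1\<rfloor>"
  have sub: "?S \<subseteq> {-m..m}"
  proof
    fix k assume "k \<in> ?S"
    then have "real_of_int \<bar>k\<bar> \<le> t / 2 - 1" using S[of k] by auto
    then have "\<bar>k\<bar> \<le> m" by (simp only: m_def le_floor_iff)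
    then show "k \<in> {-m..m}" by auto
  qed
  have fin: "finite ?S" using sub finite_subset by blast
  have "real (card ?S) \<le> t"
  proof (cases "0 \<le> m")
    case True
    have "card ?S \<le> card {-m..m}" using sub by (intro card_mono) auto
    also have "\<dots> = nat (2 * m + 1)" by simp
    finally have "real (card ?S) \<le> 2 * real_of_int m + 1" using True by linarith
    moreover have "real_of_int m \<le> t / 2 - 1" unfolding m_def by (rule of_int_floor_le)
    ultimately show ?thesis by simp
  next
    case False
    then have "?S = {}" using sub by auto
    then show ?thesis using t by simp
  qed
  then show "distr_fun (count_space UNIV) (\<lambda>k::int. ennreal ((\<bar>real_of_int k\<bar> + 1) powr b)) ((t / 2) powr b)
      \<le> ennreal t"
    using fin by (simp add: distr_fun_def emeasure_count_space ennreal_of_nat_eq_real_of_nat ennreal_leI)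
qed

lemma space_torus [simp]: "space torus = {0..1}"
  by (simp add: torus_def)

lemma emeasure_torus:
  assumes "A \<subseteq> {0..1}" "A \<in> sets borel"
  shows "emeasure torus A = emeasure lborel A"
  unfolding torus_def using assms by (subst emeasure_restrict_space) auto

text \<open>The whole space has measure 1, so every positive level is admissible. This is the source
  of the cut-off of w^(1-p') at t = 1.\<close>

lemma rearrangement_torus_eq_0:
  assumes "1 \<le> t"
  shows "rearrangement torus f t = 0"
proof (rule rearrangement_eq_0)
  fix a :: real
  have "distr_fun torus f a \<le> emeasure torus (space torus)"
    unfolding distr_fun_def by (rule emeasure_space)
  also have "\<dots> = 1" by (simp add: emeasure_torus)
  also have "\<dots> \<le> ennreal t" using assms by simp
  finally show "distr_fun torus f a \<le> ennreal t" .
qed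

text \<open>On (0,1) the function 1/W = x^(-g) is decreasing, so it exceeds t^(-g) only to the left
  of t, on a set of measure t.\<close>

lemma rearrangement_torus_powr_le:
  fixes W :: "real \<Rightarrow> real" and g t :: real
  assumes W: "\<And>x. 0 \<le> x \<Longrightarrow> x < 1 \<Longrightarrow> W x = x powr g" and g: "0 < g" and t: "0 < t" "t < 1"
  shows "rearrangement torus (\<lambda>x. 1 / ennreal (W x)) t \<le> ennreal (1 / t powr g)"
proof (rule rearrangement_le)
  show "0 < 1 / t powr g" using t by simp
  let ?S = "{x \<in> space torus. 1 / ennreal (W x) > ennreal (1 / t powr g)}"
  \<comment> \<open>The point 1 belongs to \<open>torus\<close>, but \<open>W\<close> is prescribed
    only on [0,1); it is kept as a null set.\<close>
  have "?S \<subseteq> {0..t} \<union> {1}"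
  proof
    fix x assume x: "x \<in> ?S"
    show "x \<in> {0..t} \<union> {1}"
    proof (rule ccontr)
      assume "x \<notin> {0..t} \<union> {1}"
      then have x': "t < x" "x < 1" using x by auto
      then have "1 / ennreal (W x) = ennreal (1 / x powr g)"
        using t W[of x] by (simp add: one_divide_ennreal)
      moreover have "1 / x powr g \<le> 1 / t powr g"
        using x' t g by (intro divide_left_mono powr_mono2) auto
      ultimately show False using x t by (auto simp: ennreal_less_iff)
    qed
  qed
  then have "emeasure torus ?S \<le> emeasure torus ({0..t} \<union> {1})"
    using t by (intro emeasure_mono) (auto simp: torus_def sets_restrict_space_iff)
  also have "\<dots> = emeasure lborel ({0..t} \<union> {1})"
    using t by (intro emeasure_torus) auto
  also have "\<dots> \<le> emeasure lborel {0..t} + emeasure lborel {1::real}"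
    by (rule emeasure_subadditive) auto
  also have "\<dots> = ennreal t" using t by (simp add: emeasure_lborel_Icc)
  finally show "distr_fun torus (\<lambda>x. 1 / ennreal (W x)) (1 / t powr g) \<le> ennreal t"
    unfolding distr_fun_def .
qed

section \<open>Finiteness of the weight condition\<close>

text \<open>The weight w is known only through 1/w. The bound on \<open>1 / z\<close> means z \<ge>
  y, and the negative exponent reverses the order. An infinite \<open>z\<close> has power 0, and
  \<open>z = 0\<close> is impossible because then \<open>1 / z\<close> is infinite.\<close>

lemma enn_powr_le_of_inverse_le:
  assumes "1 / z \<le> ennreal (1 / y)" "0 < y" "a < 0"
  shows "enn_powr z a \<le> ennreal (y powr a)"
proof (cases z)
  case (real x)
  have "x \<noteq> 0" using assms real by (auto simp: top_unique)
  then have "0 < x" using real by simp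
  then have "1 / x \<le> 1 / y" using assms real by (simp add: one_divide_ennreal)
  then have "y \<le> x" using assms \<open>0 < x\<close> by (simp add: field_simps)
  then have "x powr a \<le> y powr a" using assms by (intro powr_mono2') auto
  then show ?thesis using real \<open>0 < x\<close> assms by (simp add: enn_powr_def ennreal_eq_0_iff ennreal_leI)
next
  case top
  then show ?thesis using assms by (simp add: enn_powr_def)
qed

text \<open>Here \<open>v\<close> stands for w^(1-p'). The integral of \<open>u\<close> up to x is
  O(x^\<beta>), that of \<open>v\<close> up to 1/x is O(min(1, x^(-\<alpha>))). By the relation for
  r the integrand is O(x^(\<beta>r/q - 1)) near 0, and for x \<ge> 1 it gains the factor
  x^(-\<alpha>r/p'); \<open>lt\<close> then makes the exponent fall below -1.\<close>

lemma weight_condition_finite: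
  fixes p p' q r \<alpha> \<beta> A :: real and u v :: "real \<Rightarrow> ennreal"
  assumes pos: "0 < p" "0 < p'" "0 < q" "0 < r" "0 < \<alpha>" "0 < \<beta>" "0 \<le> A"
    and r: "1 / r = 1 / q - 1 / p"
    and lt: "\<beta> / q < \<alpha> / p'"
    and u: "\<And>t. 0 < t \<Longrightarrow> u t \<le> ennreal (A * t powr (\<beta> - 1))"
    and v: "\<And>t. 0 < t \<Longrightarrow> t < 1 \<Longrightarrow> v t \<le> ennreal (t powr (\<alpha> - 1))"
    and v0: "\<And>t. 1 \<le> t \<Longrightarrow> v t = 0"
  shows "(\<integral>\<^sup>+x\<in>{0<..}.
              enn_powr (\<integral>\<^sup>+s\<in>{0<..<x}. u s \<partial>lborel) (r / p) *
              enn_powr (\<integral>\<^sup>+s\<in>{0<..<1 / x}. v s \<partial>lborel) (r / p') *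
              u x \<partial>lborel) < \<infinity>" (is "(\<integral>\<^sup>+x\<in>_. ?F x \<partial>_) < _")
proof -
  \<comment> \<open>\<open>K\<close> collects the constants of the two inner integrals and of
    \<open>u\<close>; \<open>e\<^sub>0 - 1\<close> and \<open>e\<^sub>1 - 1\<close> are the
    exponents of the majorant on (0,1) and on [1,\<infinity>).\<close>
  define K where "K = (A / \<beta>) powr (r / p) * (1 / \<alpha>) powr (r / p') * A"
  define e\<^sub>0 where "e\<^sub>0 = \<beta> * r / q"
  define e\<^sub>1 where "e\<^sub>1 = \<beta> * r / q - \<alpha> * r / p'"
  have K: "0 \<le> K" using pos by (simp add: K_def)
  have e0: "0 < e\<^sub>0" using pos by (simp add: e\<^sub>0_def)
  have e1: "e\<^sub>1 < 0"
  proof -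
    have "e\<^sub>1 = r * (\<beta> / q - \<alpha> / p')" by (simp add: e\<^sub>1_def algebra_simps)
    then show ?thesis using pos lt by (simp add: mult_less_0_iff)
  qed
  \<comment> \<open>Multiplying the relation for r by r gives r/p + 1 = r/q.\<close>
  have exp_eq: "\<beta> * (r / p) + (\<beta> - 1) = e\<^sub>0 - 1"
  proof -
    have "1 = r * (1 / q - 1 / p)" using r pos by (simp flip: r)
    then have "\<beta> = \<beta> * (r * (1 / q - 1 / p))" by simp
    then show ?thesis by (simp add: e\<^sub>0_def algebra_simps)
  qed
  have Iu: "(\<integral>\<^sup>+s\<in>{0<..<x}. u s \<partial>lborel) \<le> ennreal (A / \<beta> * x powr \<beta>)" if "0 < x" for x
    using pos that u by (intro nn_integral_Ioo_powr_le) auto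
  have v1: "v t \<le> ennreal (1 * t powr (\<alpha> - 1))" if "0 < t" for t
    using v[of t] v0[of t] that by (cases "t < 1") auto
  \<comment> \<open>The parameter \<open>c\<close> covers both ranges at once: c = 1 for x \<le> 1
    and c = x^(-\<alpha>) for x \<ge> 1.\<close>
  have bound: "?F x \<le> ennreal (K * x powr (\<beta> * (r / p) + (\<beta> - 1)) * c powr (r / p'))"
    if x: "0 < x" and c: "0 \<le> c"
      and Iv: "(\<integral>\<^sup>+s\<in>{0<..<1 / x}. v s \<partial>lborel) \<le> ennreal (1 / \<alpha> * c)" for x c
  proof -
    have "?F x \<le> ennreal ((A / \<beta> * x powr \<beta>) powr (r / p)) * ennreal ((1 / \<alpha> * c) powr (r / p'))
        * ennreal (A * x powr (\<beta> - 1))"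
      using pos c x
      by (intro mult_mono order_trans[OF enn_powr_mono[OF Iu]] order_trans[OF enn_powr_mono[OF Iv]] u)
         (auto simp: enn_powr_ennreal)
    also have "\<dots> = ennreal ((A / \<beta> * x powr \<beta>) powr (r / p) * (1 / \<alpha> * c) powr (r / p')
        * (A * x powr (\<beta> - 1)))"
      using pos x by (simp add: ennreal_mult)
    also have "(A / \<beta> * x powr \<beta>) powr (r / p) * (1 / \<alpha> * c) powr (r / p') * (A * x powr (\<beta> - 1))
       = K * x powr (\<beta> * (r / p) + (\<beta> - 1)) * c powr (r / p')"
      using pos c x by (simp only: K_def powr_add powr_mult powr_powr) (simp add: powr_mult)
    finally show ?thesis .
  qed
  have small: "?F x \<le> ennreal (K * x powr (e\<^sub>0 - 1))" if x: "0 < x" "x \<le> 1" for x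
  proof -
    \<comment> \<open>As \<open>v\<close> vanishes from 1 on, enlarging the interval beyond (0,1)
      adds nothing.\<close>
    have "(\<integral>\<^sup>+s\<in>{0<..<1 / x}. v s \<partial>lborel) \<le> (\<integral>\<^sup>+s\<in>{0<..<1}. v s \<partial>lborel)"
      by (intro nn_integral_mono) (auto simp: indicator_def v0)
    also have "\<dots> \<le> ennreal (1 / \<alpha> * 1 powr \<alpha>)"
      using pos v1 by (intro nn_integral_Ioo_powr_le) auto
    finally show ?thesis using bound[of x 1] x by (simp only: exp_eq) simp
  qed
  have large: "?F x \<le> ennreal (K * x powr (e\<^sub>1 - 1))" if x: "1 \<le> x" for x
  proof -
    have "(\<integral>\<^sup>+s\<in>{0<..<1 / x}. v s \<partial>lborel) \<le> ennreal (1 / \<alpha> * (1 / x) powr \<alpha>)"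
      using pos v1 x by (intro nn_integral_Ioo_powr_le) auto
    from bound[OF _ _ this] have "?F x \<le> ennreal (K * x powr (e\<^sub>0 - 1) * ((1 / x) powr \<alpha>) powr (r / p'))"
      using x by (simp only: exp_eq) simp
    also have "((1 / x) powr \<alpha>) powr (r / p') = x powr (- (\<alpha> * r / p'))"
      using x by (simp add: powr_powr powr_divide powr_minus_divide)
    also have "K * x powr (e\<^sub>0 - 1) * x powr (- (\<alpha> * r / p')) = K * x powr (e\<^sub>1 - 1)"
      by (simp add: mult.assoc flip: powr_add) (simp add: e\<^sub>0_def e\<^sub>1_def algebra_simps)
    finally show ?thesis .
  qed
  \<comment> \<open>Domination precedes the splitting at 1, because \<open>nn_integral_add\<close>
    asks for measurability, which is immediate for the power functions.\<close>
  have "(\<integral>\<^sup>+x\<in>{0<..}. ?F x \<partial>lborel)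
      \<le> (\<integral>\<^sup>+x. ennreal (K * x powr (e\<^sub>0 - 1)) * indicator {0<..<1} x
          + ennreal (K * x powr (e\<^sub>1 - 1)) * indicator {1..} x \<partial>lborel)"
  proof (rule nn_integral_mono)
    fix x :: real
    consider "x \<le> 0" | "0 < x" "x < 1" | "1 \<le> x" by linarith
    then show "?F x * indicator {0<..} x \<le> ennreal (K * x powr (e\<^sub>0 - 1)) * indicator {0<..<1} x
          + ennreal (K * x powr (e\<^sub>1 - 1)) * indicator {1..} x"
      using small[of x] large[of x] by cases (auto simp: indicator_def)
  qed
  also have "\<dots> = (\<integral>\<^sup>+x\<in>{0<..<1}. ennreal (K * x powr (e\<^sub>0 - 1)) \<partial>lborel)
      + (\<integral>\<^sup>+x\<in>{1..}. ennreal (K * x powr (e\<^sub>1 - 1)) \<partial>lborel)"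
    by (intro nn_integral_add) auto
  also have "\<dots> < \<infinity>"
    using nn_integral_atLeast_powr[OF K e1]
      nn_integral_Ioo_powr_le[OF K e0, of 1 "\<lambda>x. ennreal (K * x powr (e\<^sub>0 - 1))"]
    by (simp add: le_less_trans[OF _ ennreal_less_top])
  finally show ?thesis .
qed

section \<open>Rudin-Shapiro polynomials\<close>

lemma sum_lessThan_add:
  fixes f :: "nat \<Rightarrow> 'a::comm_monoid_add"
  shows "(\<Sum>k<m + n. f k) = (\<Sum>k<m. f k) + (\<Sum>k<n. f (m + k))"
  by (induction n) (simp_all add: add.assoc)

text \<open>The induction step is the parallelogram law applied to
  \<open>P \<plusminus> z\<^bsup>2^n\<^esup> Q\<close> for a Rudin--Shapiro pair \<open>(P, Q)\<close>.\<close>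

lemma rudin_shapiro:
  "\<exists>a b :: nat \<Rightarrow> real. (\<forall>k. \<bar>a k\<bar> = 1 \<and> \<bar>b k\<bar> = 1) \<and>
     (\<forall>z::complex. norm z = 1 \<longrightarrow>
       (norm (\<Sum>k<2 ^ n. of_real (a k) * z ^ k))\<^sup>2 + (norm (\<Sum>k<2 ^ n. of_real (b k) * z ^ k))\<^sup>2
         = 2 ^ Suc n)"
proof (induction n)
  case 0
  show ?case by (rule exI[of _ "\<lambda>_. 1"], rule exI[of _ "\<lambda>_. 1"]) simp
next
  case (Suc n)
  then obtain a b :: "nat \<Rightarrow> real" where ab: "\<And>k. \<bar>a k\<bar> = 1" "\<And>k. \<bar>b k\<bar> = 1"
    and eq: "\<And>z::complex. norm z = 1 \<Longrightarrow>
       (norm (\<Sum>k<2 ^ n. of_real (a k) * z ^ k))\<^sup>2 + (norm (\<Sum>k<2 ^ n. of_real (b k) * z ^ k))\<^sup>2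
         = 2 ^ Suc n"
    by blast
  \<comment> \<open>\<open>c s\<close> lists the coefficients of P + s z^(2^n) Q. The shift by 2^n
    keeps the two blocks disjoint, so all coefficients remain of modulus 1 for s = 1 and s =
    -1.\<close>
  define c where "c s k = (if k < 2 ^ n then a k else s * b (k - 2 ^ n))" for s :: real and k
  have split: "(\<Sum>k<2 ^ Suc n. of_real (c s k) * z ^ k)
      = (\<Sum>k<2 ^ n. of_real (a k) * z ^ k) + of_real s * (z ^ 2 ^ n * (\<Sum>k<2 ^ n. of_real (b k) * z ^ k))"
    for s and z :: complex
  proof -
    have "(\<Sum>k<2 ^ Suc n. of_real (c s k) * z ^ k)
        = (\<Sum>k<2 ^ n. of_real (c s k) * z ^ k) + (\<Sum>k<2 ^ n. of_real (c s (2 ^ n + k)) * z ^ (2 ^ n + k))"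
      by (simp add: mult_2 sum_lessThan_add)
    then show ?thesis
      by (simp add: c_def sum_distrib_left power_add mult_ac)
  qed
  have par: "(norm (x + y))\<^sup>2 + (norm (x - y))\<^sup>2 = 2 * ((norm x)\<^sup>2 + (norm y)\<^sup>2)" for x y :: complex
    by (simp add: power2_norm_eq_inner inner_add_left inner_diff_left inner_add_right inner_diff_right)
  show ?case
  proof (rule exI[of _ "c 1"], rule exI[of _ "c (-1)"], intro conjI allI impI)
    show "\<bar>c 1 k\<bar> = 1" "\<bar>c (-1) k\<bar> = 1" for k
      by (simp_all add: c_def ab)
    fix z :: complex assume z: "norm z = 1"
    \<comment> \<open>On the unit circle the factor z^(2^n) does not change the norm of Q, so the
      sum of squares exactly doubles.\<close>
    show "(norm (\<Sum>k<2 ^ Suc n. of_real (c 1 k) * z ^ k))\<^sup>2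
        + (norm (\<Sum>k<2 ^ Suc n. of_real (c (-1) k) * z ^ k))\<^sup>2 = 2 ^ Suc (Suc n)"
      unfolding split
      using par[of "\<Sum>k<2 ^ n. of_real (a k) * z ^ k" "z ^ 2 ^ n * (\<Sum>k<2 ^ n. of_real (b k) * z ^ k)"] eq[OF z]
      by (simp add: norm_mult norm_power z)
  qed
qed

section \<open>Fourier coefficients of flat trigonometric polynomials\<close>

text \<open>Orthonormality of the characters: the product is exp(cx) with c = 2\<pi>i(j - k), and
  for c \<noteq> 0 its primitive exp(cx)/c agrees at 0 and 1.\<close>

lemma fourier_coeff_exp:
  fixes j k :: int
  shows "(\<integral>x. exp (2 * of_real pi * \<i> * of_int j * complex_of_real x)
            * exp (- (2 * of_real pi * \<i> * of_int k * complex_of_real x)) \<partial>torus)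
         = (if j = k then 1 else 0)"
proof -
  define c where "c = 2 * complex_of_real pi * \<i> * of_int (j - k)"
  have eq: "exp (2 * of_real pi * \<i> * of_int j * complex_of_real x)
            * exp (- (2 * of_real pi * \<i> * of_int k * complex_of_real x)) = exp (c * of_real x)" for x
    by (simp add: c_def algebra_simps flip: exp_add)
  have "(\<integral>x. exp (c * complex_of_real x) \<partial>torus) = integral {0..1} (\<lambda>x. exp (c * complex_of_real x))"
    unfolding torus_def
    by (intro lebesgue_integral_eq_integral continuous_imp_integrable_real continuous_intros) auto
  also have "\<dots> = (if j = k then 1 else 0)"
  proof (cases "j = k")
    case True
    then show ?thesis by (simp add: c_def)
  next
    case False
    then have c: "c \<noteq> 0" by (simp add: c_def)
    have c1: "exp c = 1"
      unfolding c_def exp_eq_1 by (auto intro!: exI[of _ "j - k"])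
    have "((\<lambda>x. exp (c * complex_of_real x)) has_integral
        exp (c * complex_of_real 1) / c - exp (c * complex_of_real 0) / c) {0..1}"
      using c by (intro fundamental_theorem_of_calculus)
        (auto intro!: derivative_eq_intros has_vector_derivative_real_field simp: field_simps)
    then show ?thesis using False c1 by (simp add: integral_unique)
  qed
  finally show ?thesis by (simp add: eq)
qed

lemma fourier_coeff_trig_poly:
  fixes a :: "nat \<Rightarrow> complex"
  assumes "k < N"
  shows "fourier_coeff (\<lambda>x. \<Sum>j<N. a j * exp (2 * of_real pi * \<i> * of_int (int j) * complex_of_real x)) (int k)
     = a k"
proof -
  have "fourier_coeff (\<lambda>x. \<Sum>j<N. a j * exp (2 * of_real pi * \<i> * of_int (int j) * complex_of_real x)) (int k)
     = (\<integral>x. (\<Sum>j<N. a j * (exp (2 * of_real pi * \<i> * of_int (int j) * complex_of_real x)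
          * exp (- (2 * of_real pi * \<i> * of_int (int k) * complex_of_real x)))) \<partial>torus)"
    by (simp add: fourier_coeff_def sum_distrib_right mult.assoc)
  also have "\<dots> = (\<Sum>j<N. a j * (\<integral>x. exp (2 * of_real pi * \<i> * of_int (int j) * complex_of_real x)
          * exp (- (2 * of_real pi * \<i> * of_int (int k) * complex_of_real x)) \<partial>torus))"
    unfolding torus_def
    by (subst Bochner_Integration.integral_sum)
       (auto intro!: continuous_imp_integrable_real continuous_intros)
  also have "\<dots> = (\<Sum>j<N. if j = k then a j else 0)"
    unfolding fourier_coeff_exp by (intro sum.cong) auto
  also have "\<dots> = a k" using assms by simp
  finally show ?thesis .
qed

text \<open>Take the first member P of a Rudin-Shapiro pair on the unit circle, divided by the
  square root of 2^(n+1). Dropping |Q|^2 from |P|^2 + |Q|^2 = 2^(n+1) gives the sup bound, while the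
  coefficients keep a common modulus.\<close>

lemma flat_trig_poly:
  "\<exists>f :: real \<Rightarrow> complex. integrable torus f \<and> (\<forall>x. norm (f x) \<le> 1) \<and>
     (\<forall>k<2 ^ n. norm (fourier_coeff f (int k)) = 1 / sqrt (2 ^ Suc n))"
proof -
  obtain a b :: "nat \<Rightarrow> real" where ab: "\<And>k. \<bar>a k\<bar> = 1"
    and eq: "\<And>z::complex. norm z = 1 \<Longrightarrow>
       (norm (\<Sum>k<2 ^ n. of_real (a k) * z ^ k))\<^sup>2 + (norm (\<Sum>k<2 ^ n. of_real (b k) * z ^ k))\<^sup>2
         = 2 ^ Suc n"
    using rudin_shapiro[of n] by blast
  define s where "s = sqrt (2 ^ Suc n)"
  have s: "0 < s" "s\<^sup>2 = 2 ^ Suc n" by (simp_all add: s_def)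
  define f where "f = (\<lambda>x. \<Sum>j<2 ^ n. complex_of_real (a j / s)
      * exp (2 * of_real pi * \<i> * of_int (int j) * complex_of_real x))"
  have "integrable torus f"
    unfolding torus_def f_def by (intro continuous_imp_integrable_real continuous_intros)
  moreover have "norm (f x) \<le> 1" for x
  proof -
    define z where "z = exp (2 * of_real pi * \<i> * complex_of_real x)"
    have z: "norm z = 1" by (simp add: z_def norm_exp_eq_Re)
    have "f x = (\<Sum>j<2 ^ n. of_real (a j) * z ^ j) / of_real s"
      by (simp add: f_def z_def sum_divide_distrib mult_ac flip: exp_of_nat_mult)
    moreover have "(norm (\<Sum>j<2 ^ n. of_real (a j) * z ^ j))\<^sup>2 \<le> s\<^sup>2"
      unfolding s(2) eq[OF z, symmetric] by simp
    ultimately show ?thesis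
      using s(1) power2_le_imp_le[of "norm (\<Sum>j<2 ^ n. of_real (a j) * z ^ j)" s]
      by (simp add: norm_divide)
  qed
  moreover have "norm (fourier_coeff f (int k)) = 1 / s" if "k < 2 ^ n" for k
    unfolding f_def fourier_coeff_trig_poly[OF that] using s(1) ab by (simp add: norm_divide)
  ultimately show ?thesis unfolding s_def by blast
qed

section \<open>Estimates for the two sides of the Fourier inequality\<close>

text \<open>Only the frequencies 0, ..., N - 1 are retained. There k + 1 \<le> N, so with
  \<open>b \<le> 0\<close> each weight is at least N^b.\<close>

lemma weighted_coeff_sum_ge:
  fixes f :: "real \<Rightarrow> complex" and b q d :: real and N :: nat
  assumes "b \<le> 0" "0 < q" "0 \<le> d"
    and d: "\<And>k. k < N \<Longrightarrow> norm (fourier_coeff f (int k)) = d"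
  shows "ennreal (N * (d powr q * N powr b))
    \<le> (\<integral>\<^sup>+k. ennreal (norm (fourier_coeff f k) powr q * (\<bar>real_of_int k\<bar> + 1) powr b) \<partial>count_space UNIV)"
    (is "_ \<le> (\<integral>\<^sup>+k. ?g k \<partial>_)")
proof -
  have "ennreal (N * (d powr q * N powr b)) = (\<Sum>k<N. ennreal (d powr q * N powr b))"
    by (simp add: ennreal_mult ennreal_of_nat_eq_real_of_nat)
  also have "\<dots> \<le> (\<Sum>k<N. ?g (int k))"
    using assms by (intro sum_mono ennreal_leI) (auto intro!: mult_left_mono powr_mono2')
  also have "\<dots> = (\<integral>\<^sup>+k. ?g k \<partial>count_space (int ` {..<N}))"
    by (simp add: nn_integral_count_space_finite sum.reindex)
  also have "\<dots> \<le> (\<integral>\<^sup>+k. ?g k \<partial>count_space UNIV)"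
    by (subst nn_integral_count_space_indicator) (auto intro!: nn_integral_mono simp: indicator_def)
  finally show ?thesis .
qed

text \<open>The integrand is at most 1 on a space of measure 1. The argument is almost everywhere
  because \<open>W\<close> is arbitrary, possibly large, at the point 1.\<close>

lemma torus_weighted_norm_le:
  fixes f :: "real \<Rightarrow> complex" and W :: "real \<Rightarrow> real"
  assumes W: "\<And>x. 0 \<le> x \<Longrightarrow> x < 1 \<Longrightarrow> W x \<in> {0..1}" and f: "\<And>x. norm (f x) \<le> 1" and "0 < p"
  shows "(\<integral>\<^sup>+x. ennreal (norm (f x) powr p * W x) \<partial>torus) \<le> 1"
proof -
  have "AE x in torus. x \<noteq> 1"
  proof (rule AE_I)
    show "{1} \<in> sets torus" by (simp add: torus_def sets_restrict_space_iff)
    show "emeasure torus {1} = 0"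
      unfolding torus_def by (subst emeasure_restrict_space) auto
  qed auto
  then have "AE x in torus. ennreal (norm (f x) powr p * W x) \<le> 1"
  proof (rule AE_mp, intro AE_I2 impI)
    fix x assume "x \<in> space torus" "x \<noteq> 1"
    then have x: "0 \<le> x" "x < 1" by (auto simp: torus_def)
    have "norm (f x) powr p \<le> 1" using f \<open>0 < p\<close> by (intro powr_le1) auto
    then have "norm (f x) powr p * W x \<le> 1 * 1" using W[OF x] by (intro mult_mono) auto
    then show "ennreal (norm (f x) powr p * W x) \<le> 1" by simp
  qed
  then have "(\<integral>\<^sup>+x. ennreal (norm (f x) powr p * W x) \<partial>torus) \<le> (\<integral>\<^sup>+x. 1 \<partial>torus)"
    by (rule nn_integral_mono_AE)
  also have "\<dots> = 1"
    unfolding torus_def by (simp add: emeasure_restrict_space)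
  finally show ?thesis .
qed

section \<open>Combination of the estimates for the given weights\<close>

theorem mainTheorem7:
  fixes p p' q r \<alpha> \<beta> :: real
    and U :: "int \<Rightarrow> real" and W :: "real \<Rightarrow> real"
    and u w :: "real \<Rightarrow> ennreal"
  assumes "1 < q" and "q < 2" and "2 < p"
    and "1 / p + 1 / p' = 1"
    and "1 / r = 1 / q - 1 / p"
    and "\<alpha> \<in> {0<..<1}" and "\<beta> \<in> {0<..<1}"
    and "1 / 2 < \<beta> / q" and "\<beta> / q < \<alpha> / p'" and "\<alpha> / p' < 1 / q" and "1 / q < 1"
    and U: "\<And>k. U k = (\<bar>real_of_int k\<bar> + 1) powr (\<beta> - 1)"
    and W: "\<And>x. 0 \<le> x \<Longrightarrow> x < 1 \<Longrightarrow> W x = x powr ((1 - \<alpha>) * (p - 1))"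
    and u: "\<And>t. 0 < t \<Longrightarrow> u t = rearrangement (count_space UNIV) (\<lambda>k. ennreal (U k)) t"
    and w: "\<And>t. 0 < t \<Longrightarrow> 1 / w t = rearrangement torus (\<lambda>x. 1 / ennreal (W x)) t"
  shows "enn_powr
           (\<integral>\<^sup>+x\<in>{0<..}.
              enn_powr (\<integral>\<^sup>+s\<in>{0<..<x}. u s \<partial>lborel) (r / p) *
              enn_powr (\<integral>\<^sup>+s\<in>{0<..<1 / x}. enn_powr (w s) (1 - p') \<partial>lborel) (r / p') *
              u x \<partial>lborel)
           (1 / r) < \<infinity>
         \<and> \<not> (\<exists>C\<ge>0::real. \<forall>f :: real \<Rightarrow> complex. integrable torus f \<longrightarrow>
              enn_powr (\<integral>\<^sup>+k. ennreal (norm (fourier_coeff f k) powr q * U k) \<partial>count_space UNIV) (1 / q)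
              \<le> ennreal C * enn_powr (\<integral>\<^sup>+x. ennreal (norm (f x) powr p * W x) \<partial>torus) (1 / p))"
proof (intro conjI notI)
  have pos: "0 < p" "0 < q" "0 < \<alpha>" "0 < \<beta>" "\<alpha> < 1" "\<beta> < 1"
    using assms by auto
  have p': "p' = p / (p - 1)"
  proof -
    have "1 / p' = (p - 1) / p"
      using assms(3,4) by (simp add: field_simps)
    then show ?thesis by (metis divide_divide_eq_right div_by_1 mult_1)
  qed
  have p'_gt: "1 < p'" using assms(3) by (simp add: p' field_simps)
  have r: "0 < r"
  proof -
    have "1 / p < 1 / q" using assms(1-3) by (intro divide_strict_left_mono) auto
    then have "0 < 1 / r" using assms(5) by simp
    then show ?thesis by simp
  qed
  define g where "g = (1 - \<alpha>) * (p - 1)"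
  have g: "0 < g" using assms pos by (simp add: g_def)
  \<comment> \<open>Conjugacy in the form (p - 1)(p' - 1) = 1: the exponent of \<open>W\<close> is
    chosen so that w^(1-p') behaves like t^(\<alpha>-1).\<close>
  have g_exp: "g * (1 - p') = \<alpha> - 1"
    using assms(3) by (simp add: g_def p' field_simps)
  have Ufun: "U = (\<lambda>k. (\<bar>real_of_int k\<bar> + 1) powr (\<beta> - 1))" using U by auto

  have u_le: "u t \<le> ennreal ((1 / 2) powr (\<beta> - 1) * t powr (\<beta> - 1))" if "0 < t" for t
  proof -
    have "u t \<le> ennreal ((t / 2) powr (\<beta> - 1))"
      unfolding u[OF that] Ufun using pos that by (intro rearrangement_int_powr_le) auto
    also have "(t / 2) powr (\<beta> - 1) = (1 / 2) powr (\<beta> - 1) * t powr (\<beta> - 1)"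
      using that by (simp flip: powr_mult)
    finally show ?thesis .
  qed
  have w_le: "enn_powr (w t) (1 - p') \<le> ennreal (t powr (\<alpha> - 1))" if t: "0 < t" "t < 1" for t
  proof -
    have "1 / w t \<le> ennreal (1 / t powr g)"
      unfolding w[OF t(1)] using W g t by (intro rearrangement_torus_powr_le) (auto simp: g_def)
    from enn_powr_le_of_inverse_le[OF this, of "1 - p'"] p'_gt t show ?thesis
      by (simp add: powr_powr g_exp)
  qed
  \<comment> \<open>Here 1/w = 0 forces w = \<infinity>, and the convention for a negative exponent
    yields the value 0.\<close>
  have w_eq_0: "enn_powr (w t) (1 - p') = 0" if "1 \<le> t" for t
  proof -
    have "1 / w t = 0" using w[of t] rearrangement_torus_eq_0[OF that] that by simp
    then show ?thesis using p'_gt by (simp add: enn_powr_def)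
  qed
  let ?I = "\<integral>\<^sup>+x\<in>{0<..}.
              enn_powr (\<integral>\<^sup>+s\<in>{0<..<x}. u s \<partial>lborel) (r / p) *
              enn_powr (\<integral>\<^sup>+s\<in>{0<..<1 / x}. enn_powr (w s) (1 - p') \<partial>lborel) (r / p') *
              u x \<partial>lborel"
  have "?I < \<infinity>"
    by (rule weight_condition_finite[where q = q and \<alpha> = \<alpha> and \<beta> = \<beta> and A = "(1 / 2) powr (\<beta> - 1)"])
       (use pos r p'_gt assms(5,9) u_le w_le w_eq_0 in auto)
  then obtain y where "?I = ennreal y" "0 \<le> y"
    by (cases ?I) auto
  then show "enn_powr ?I (1 / r) < \<infinity>"
    using r by (simp add: enn_powr_ennreal)

  \<comment> \<open>Failure of the Fourier inequality\<close>
  assume "\<exists>C\<ge>0::real. \<forall>f :: real \<Rightarrow> complex. integrable torus f \<longrightarrow>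
              enn_powr (\<integral>\<^sup>+k. ennreal (norm (fourier_coeff f k) powr q * U k) \<partial>count_space UNIV) (1 / q)
              \<le> ennreal C * enn_powr (\<integral>\<^sup>+x. ennreal (norm (f x) powr p * W x) \<partial>torus) (1 / p)"
  then obtain C where C: "0 \<le> C"
    and ineq: "\<And>f :: real \<Rightarrow> complex. integrable torus f \<Longrightarrow>
              enn_powr (\<integral>\<^sup>+k. ennreal (norm (fourier_coeff f k) powr q * U k) \<partial>count_space UNIV) (1 / q)
              \<le> ennreal C * enn_powr (\<integral>\<^sup>+x. ennreal (norm (f x) powr p * W x) \<partial>torus) (1 / p)"
    by blast
  \<comment> \<open>The growth rate in n of the base-2 logarithm of the left-hand side: the q-th
    root of 2^n * 2^(-nq/2) * 2^(n(\<beta>-1)) is 2^(n(\<beta>/q - 1/2)).\<close>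
  define e where "e = \<beta> / q - 1 / 2"
  have e: "0 < e" using assms(8) by (simp add: e_def)
  have bound: "2 powr (real n * e - 1 / 2) \<le> C" for n
  proof -
    obtain f :: "real \<Rightarrow> complex" where f: "integrable torus f" "\<And>x. norm (f x) \<le> 1"
      and coeff: "\<And>k. k < 2 ^ n \<Longrightarrow> norm (fourier_coeff f (int k)) = 1 / sqrt (2 ^ Suc n)"
      using flat_trig_poly[of n] by blast
    let ?S = "\<integral>\<^sup>+k. ennreal (norm (fourier_coeff f k) powr q * U k) \<partial>count_space UNIV"
    let ?J = "\<integral>\<^sup>+x. ennreal (norm (f x) powr p * W x) \<partial>torus"
    \<comment> \<open>The lower bound for \<open>?S\<close> from N = 2^n equal coefficients, written
      as a q-th power; the -1/2 comes from the n + 1, rather than n, in the normalisation.\<close>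
    let ?s = "2 powr (q * (real n * e - 1 / 2))"
    have "?s = real (2 ^ n) * ((1 / sqrt (2 ^ Suc n)) powr q * real (2 ^ n) powr (\<beta> - 1))"
    proof -
      have "sqrt (2 ^ Suc n) = 2 powr ((real n + 1) / 2)"
        by (simp add: powr_half_sqrt[symmetric] powr_realpow[symmetric] powr_powr add.commute
            del: power_Suc)
      then have "1 / sqrt (2 ^ Suc n) = 2 powr (- ((real n + 1) / 2))"
        by (simp only: powr_minus_divide)
      moreover have "real (2 ^ n) = 2 powr real n"
        by (simp add: powr_realpow)
      ultimately have "real (2 ^ n) * ((1 / sqrt (2 ^ Suc n)) powr q * real (2 ^ n) powr (\<beta> - 1))
          = 2 powr (real n + (- ((real n + 1) / 2) * q + real n * (\<beta> - 1)))"
        by (simp only: powr_powr powr_add)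
      also have "real n + (- ((real n + 1) / 2) * q + real n * (\<beta> - 1)) = q * (real n * e - 1 / 2)"
        using pos by (simp add: e_def field_simps)
      finally show ?thesis by simp
    qed
    then have "ennreal ?s \<le> ?S"
      unfolding Ufun
      using weighted_coeff_sum_ge[of "\<beta> - 1" q "1 / sqrt (2 ^ Suc n)" "2 ^ n" f] coeff pos by simp
    then have "enn_powr (ennreal ?s) (1 / q) \<le> enn_powr ?S (1 / q)"
      using pos by (intro enn_powr_mono) auto
    also have "enn_powr (ennreal ?s) (1 / q) = ennreal (2 powr (real n * e - 1 / 2))"
      using pos by (simp add: enn_powr_ennreal powr_powr)
    also note ineq[OF f(1)]
    \<comment> \<open>Since \<open>g > 0\<close>, W \<le> 1 on [0,1), so the right-hand side is
      bounded by C uniformly in n.\<close>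
    also have "ennreal C * enn_powr ?J (1 / p) \<le> ennreal C * enn_powr 1 (1 / p)"
    proof (intro mult_left_mono enn_powr_mono torus_weighted_norm_le)
      show "W x \<in> {0..1}" if "0 \<le> x" "x < 1" for x
        using W[OF that] g that by (auto simp: g_def intro!: powr_le1)
    qed (use f pos in auto)
    also have "\<dots> = ennreal C" by (simp add: enn_powr_def)
    finally show ?thesis using C by simp
  qed
  have "filterlim (\<lambda>n. 2 powr (real n * e - 1 / 2)) at_top sequentially"
    using e by real_asymp
  then have "eventually (\<lambda>n. C < 2 powr (real n * e - 1 / 2)) sequentially"
    by (simp add: filterlim_at_top_dense)
  then obtain n where "C < 2 powr (real n * e - 1 / 2)"
    by (auto simp: eventually_sequentially)
  with bound[of n] show False by simp
qed

end
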